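(* Let $N\ge 2$, let $n_1\ge 0$ and $n_2,\dots,n_N\ge 1$ be integers, write $|n|=n_2+\cdots+n_N$ and $|k|=k_2+\cdots+k_N$, and let $s$ be a fixed vertex of the complete $N$-partite graph $K_{n_1+1,n_2,\dots,n_N}$. The number of acyclic orientations of $K_{n_1+1,n_2,\dots,n_N}$ whose unique sink is $s$ equals \[ \sum_{(k_2,\dots,k_N)\in[n_2]\times\cdots\times[n_N]} (-1)^{|n|-|k|}\,|k|^{n_1}\,|k|!\,\prod_{i=2}^N \left\{ {n_i \atop k_i} \right\}, \] where $\left\{ {a \atop b} \right\}$ is the Stirling number of the second kind.
   Context: $K_{m_1,\dots,m_N}$ is the complete multipartite graph with parts of sizes $m_1,\dots,m_N$, two vertices adjacent iff in different parts. An acyclic orientation is an orientation of all edges with no directed cycle; a sink is a vertex with no outgoing edge. The number of acyclic orientations with unique sink equal to $s$ does not depend on the choice of $s$. $[a]=\{1,\dots,a\}$. *)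

theory Defs
  imports Complex_Main "HOL-Library.FuncSet" "HOL-Combinatorics.Stirling"
begin

text \<open>
  A graph is given by its vertex set together with its (symmetric, irreflexive) adjacency
  relation. The \<open>j\<close>-th vertex of the \<open>i\<close>-th part of the complete multipartite graph is the
  pair \<open>(i, j)\<close>; parts are indexed by \<open>{1..N}\<close>, and part \<open>i\<close> has \<open>m i\<close> vertices.
\<close>

definition multipartite_verts :: "nat \<Rightarrow> (nat \<Rightarrow> nat) \<Rightarrow> (nat \<times> nat) set" where
  "multipartite_verts N m = (SIGMA i:{1..N}. {1..m i})"

definition multipartite_adj :: "nat \<Rightarrow> (nat \<Rightarrow> nat) \<Rightarrow> (nat \<times> nat) rel" where
  "multipartite_adj N m =
     {(u, v). u \<in> multipartite_verts N m \<and> v \<in> multipartite_verts N m \<and> fst u \<noteq> fst v}"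

text \<open>
  An orientation selects exactly one of the two directions \<open>(u, v)\<close>, \<open>(v, u)\<close> of every edge;
  \<open>(u, v) \<in> R\<close> means that the edge points from \<open>u\<close> to \<open>v\<close>.
\<close>

definition orientation :: "'a rel \<Rightarrow> 'a rel \<Rightarrow> bool" where
  "orientation E R \<longleftrightarrow>
     R \<subseteq> E \<and> (\<forall>u v. (u, v) \<in> E \<longrightarrow> ((u, v) \<in> R \<longleftrightarrow> (v, u) \<notin> R))"

definition is_sink :: "'a set \<Rightarrow> 'a rel \<Rightarrow> 'a \<Rightarrow> bool" where
  "is_sink V R v \<longleftrightarrow> v \<in> V \<and> (\<forall>w. (v, w) \<notin> R)"

definition acyclic_orientations_unique_sink :: "'a set \<Rightarrow> 'a rel \<Rightarrow> 'a \<Rightarrow> 'a rel set" where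
  "acyclic_orientations_unique_sink V E s =
     {R. orientation E R \<and> acyclic R \<and> {v. is_sink V R v} = {s}}"

end

theory Submission
  imports Defs "HOL-Computational_Algebra.Polynomial"
begin

text \<open>
  The orientations in which a given independent set \<open>S\<close> consists of sinks correspond to the acyclic
  orientations of the graph without \<open>S\<close>, so inclusion-exclusion over sets of sinks expresses both
  the number of acyclic orientations and the number of those with unique sink \<open>s\<close> through numbers
  of acyclic orientations of smaller induced subgraphs. For complete multipartite graphs these
  recursions are solved by the functional \<open>\<Phi>\<close> that sends \<open>x ^ k\<close> to \<open>k!\<close>, applied to
  products of the polynomials \<open>p\<^sub>n = (\<Sum>k\<le>n. (-1) ^ (n - k) S(n, k) x ^ k)\<close>: deleting a nonempty
  set from one part turns into \<open>pderiv\<close>, and \<open>\<Phi>(q') = \<Phi>(q) - q(0)\<close>. Prescribing a sink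
  replaces one factor \<open>p\<^sub>n\<close> by \<open>p\<^sub>n / x\<close>.
\<close>

section \<open>Signed Stirling polynomials\<close>

text \<open>Up to signs this is the Touchard polynomial \<open>T_n\<close>: the value is
  \<open>(-1)^n T_n(-x)\<close>.\<close>

definition stirling_poly :: "nat \<Rightarrow> int poly" where
  "stirling_poly n = (\<Sum>k\<le>n. monom ((-1) ^ (n - k) * int (Stirling n k)) k)"

text \<open>The exponent \<open>n + k\<close> has the parity of \<open>n - k\<close> but needs no
  truncated subtraction, so the formula also covers \<open>k > n\<close>, where the Stirling number
  vanishes.\<close>

lemma coeff_stirling_poly:
  "coeff (stirling_poly n) k = (-1) ^ (n + k) * int (Stirling n k)"
proof (cases "k \<le> n")
  case True
  then have "(-1 :: int) ^ (n - k) = (-1) ^ (n + k)"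
    by (simp add: minus_one_power_iff)
  with True show ?thesis
    by (simp add: stirling_poly_def coeff_sum sum.delta)
next
  case False
  then show ?thesis
    by (simp add: stirling_poly_def coeff_sum)
qed

lemma stirling_poly_0 [simp]: "stirling_poly 0 = 1"
  by (simp add: stirling_poly_def)

lemma Stirling_pos_0 [simp]: "n > 0 \<Longrightarrow> Stirling n 0 = 0"
  by (cases n) auto

text \<open>This is the recurrence of the Stirling numbers: the factor \<open>Suc k\<close> in it
  comes from \<open>pderiv\<close>, and the alternating signs turn the sum into a
  difference.\<close>

lemma stirling_poly_Suc:
  "stirling_poly (Suc n) = pCons 0 (stirling_poly n - pderiv (stirling_poly n))"
proof (rule poly_eqI)
  fix k
  show "coeff (stirling_poly (Suc n)) k
      = coeff (pCons 0 (stirling_poly n - pderiv (stirling_poly n))) k"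
    by (cases k) (simp_all add: coeff_stirling_poly coeff_pderiv algebra_simps)
qed

text \<open>Pascal's rule, with both halves reindexed so that only binomials over \<open>n\<close>
  remain.\<close>

lemma binomial_convolution_Suc:
  fixes f :: "nat \<Rightarrow> 'a :: comm_ring_1"
  shows "(\<Sum>j\<le>Suc n. of_nat (Suc n choose j) * (-1) ^ j * f (Suc n - j)) =
    (\<Sum>j\<le>n. of_nat (n choose j) * (-1) ^ j * f (Suc (n - j)))
    - (\<Sum>j\<le>n. of_nat (n choose j) * (-1) ^ j * f (n - j))"
proof -
  have "(\<Sum>j\<le>n. of_nat (n choose Suc j) * (-1) ^ Suc j * f (n - j)) + f (Suc n)
      = (\<Sum>j\<le>Suc n. of_nat (n choose j) * (-1) ^ j * f (Suc n - j))"
    by (simp add: sum.atMost_Suc_shift del: sum.atMost_Suc)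
  \<comment> \<open>The term \<open>j = Suc n\<close> vanishes because \<open>n choose Suc n\<close>
    is 0.\<close>
  also have "\<dots> = (\<Sum>j\<le>n. of_nat (n choose j) * (-1) ^ j * f (Suc (n - j)))"
    by (simp add: Suc_diff_le binomial_eq_0)
  finally show ?thesis
    by (simp add: sum.atMost_Suc_shift algebra_simps sum.distrib sum_negf sum_subtractf del: sum.atMost_Suc)
qed

lemma pderiv_sum: "pderiv (\<Sum>x\<in>A. f x) = (\<Sum>x\<in>A. pderiv (f x))"
  by (induction A rule: infinite_finite_induct) (simp_all add: pderiv_add)

text \<open>The exponential generating function \<open>G\<close> of the polynomials in
  \<open>t\<close> is \<open>exp(x (1 - e^(-t)))\<close>. Its \<open>x\<close>-derivative is
  \<open>(1 - e^(-t)) G\<close>, so the left side has generating function \<open>e^(-t) G\<close>.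
  The induction proves this without power series.\<close>

lemma stirling_poly_diff_pderiv:
  "stirling_poly n - pderiv (stirling_poly n) =
    (\<Sum>j\<le>n. of_nat (n choose j) * (-1) ^ j * stirling_poly (n - j))"
proof (induction n)
  case 0
  then show ?case by simp
next
  case (Suc n)
  let ?B = "stirling_poly n - pderiv (stirling_poly n)"
  have pd: "pderiv (of_nat m * (-1) ^ j * p) = of_nat m * (-1) ^ j * pderiv p"
    for m j and p :: "int poly"
    by (cases "even j") (simp_all add: pderiv_mult pderiv_minus)
  have "(\<Sum>j\<le>n. of_nat (n choose j) * (-1) ^ j * stirling_poly (Suc (n - j)))
    = [:0, 1:] * (\<Sum>j\<le>n. of_nat (n choose j) * (-1) ^ j *
         (stirling_poly (n - j) - pderiv (stirling_poly (n - j))))"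
    by (simp add: stirling_poly_Suc sum_distrib_left algebra_simps)
  \<comment> \<open>The hypothesis enters twice, for \<open>?B\<close> and, differentiated termwise
    by \<open>pd\<close>, for \<open>pderiv ?B\<close>.\<close>
  also have "\<dots> = [:0, 1:] * (?B - pderiv ?B)"
    unfolding Suc.IH by (simp add: pd right_diff_distrib sum_subtractf pderiv_sum)
  finally have "(\<Sum>j\<le>Suc n. of_nat (Suc n choose j) * (-1) ^ j * stirling_poly (Suc n - j))
      = [:0, 1:] * (?B - pderiv ?B) - ?B"
    unfolding binomial_convolution_Suc Suc.IH[symmetric] by simp
  also have "\<dots> = stirling_poly (Suc n) - pderiv (stirling_poly (Suc n))"
  proof -
    have "stirling_poly (Suc n) - pderiv (stirling_poly (Suc n))
        = pCons 0 ?B - (?B + pCons 0 (pderiv ?B))"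
      by (simp only: stirling_poly_Suc pderiv_pCons)
    moreover have "[:0, 1:] * (p - q) - p = pCons 0 p - (p + pCons 0 q)" for p q :: "int poly"
      by (simp flip: diff_pCons)
    ultimately show ?thesis
      by (simp only:)
  qed
  finally show ?case ..
qed

text \<open>The shape needed for deleting a nonempty set of \<open>j\<close> vertices from a part of
  size \<open>n\<close>.\<close>

lemma pderiv_stirling_poly:
  "pderiv (stirling_poly n) =
    - (\<Sum>j=1..n. of_nat (n choose j) * (-1) ^ j * stirling_poly (n - j))"
proof -
  have "{..n} = insert 0 {1..n}" by auto
  then show ?thesis
    using stirling_poly_diff_pderiv[of n] by (simp add: algebra_simps)
qed

section \<open>The factorial functional\<close>

text \<open>Formally the integral of \<open>p(x) e^(-x)\<close> over the nonnegative reals, written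
  as a finite sum to stay within the integers.\<close>

definition fact_functional :: "int poly \<Rightarrow> int" where
  "fact_functional p = (\<Sum>k\<le>degree p. coeff p k * fact k)"

text \<open>A free upper bound lets polynomials of different degrees share one range of
  summation.\<close>

lemma fact_functional_altdef:
  assumes "degree p \<le> d"
  shows "fact_functional p = (\<Sum>k\<le>d. coeff p k * fact k)"
  unfolding fact_functional_def
  by (rule sum.mono_neutral_left) (use assms in \<open>auto simp: coeff_eq_0\<close>)

lemma fact_functional_add:
  "fact_functional (p + q) = fact_functional p + fact_functional q"
proof -
  define d where "d = max (degree p) (degree q)"
  have "degree p \<le> d" "degree q \<le> d" "degree (p + q) \<le> d"
    by (auto simp: d_def degree_add_le_max)
  then show ?thesis
    by (simp add: fact_functional_altdef sum.distrib algebra_simps)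
qed

lemma fact_functional_smult: "fact_functional (smult a p) = a * fact_functional p"
proof -
  have "degree (smult a p) \<le> degree p"
    by (rule degree_smult_le)
  then show ?thesis
    by (simp add: fact_functional_altdef[of "smult a p" "degree p"] fact_functional_def
        sum_distrib_left mult.assoc)
qed

lemma fact_functional_0 [simp]: "fact_functional 0 = 0"
  by (simp add: fact_functional_def)

lemma fact_functional_minus: "fact_functional (- p) = - fact_functional p"
  using fact_functional_smult[of "-1" p] by simp

lemma fact_functional_diff:
  "fact_functional (p - q) = fact_functional p - fact_functional q"
  using fact_functional_add[of p "- q"] by (simp add: fact_functional_minus)

lemma fact_functional_sum:
  "fact_functional (\<Sum>x\<in>A. f x) = (\<Sum>x\<in>A. fact_functional (f x))"
  by (induction A rule: infinite_finite_induct) (simp_all add: fact_functional_add)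

lemma fact_functional_monom: "fact_functional (monom a k) = a * fact k"
proof -
  have "fact_functional (monom a k) = (\<Sum>i\<le>k. coeff (monom a k) i * fact i)"
    by (rule fact_functional_altdef) (rule degree_monom_le)
  also have "\<dots> = (\<Sum>i\<le>k. if i = k then a * fact k else 0)"
    by (rule sum.cong) auto
  finally show ?thesis by simp
qed

text \<open>Integration by parts: differentiating \<open>x^k\<close> and applying the functional
  gives \<open>k * (k-1)! = k!\<close> again, except that the constant term is lost.\<close>

lemma fact_functional_pderiv: "fact_functional (pderiv p) = fact_functional p - coeff p 0"
proof -
  let ?d = "degree p"
  have "degree (pderiv p) \<le> ?d"
    by (simp add: degree_pderiv)
  then have "fact_functional (pderiv p) = (\<Sum>k\<le>?d. coeff p (Suc k) * fact (Suc k))"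
    by (simp add: fact_functional_altdef coeff_pderiv algebra_simps)
  also have "\<dots> = (\<Sum>k\<le>Suc ?d. coeff p k * fact k) - coeff p 0"
    by (simp add: sum.atMost_Suc_shift del: sum.atMost_Suc)
  also have "(\<Sum>k\<le>Suc ?d. coeff p k * fact k) = fact_functional p"
    by (rule fact_functional_altdef[symmetric]) simp
  finally show ?thesis .
qed

text \<open>Each increment of \<open>n\<close> multiplies the value by \<open>k\<close>, starting
  from \<open>k!\<close>. This is the source of the factors \<open>|k|^{n_1}\<close> and
  \<open>|k|!\<close> in the final formula.\<close>

lemma fact_functional_monom_mult_diff:
  "fact_functional (monom 1 k * (stirling_poly n - pderiv (stirling_poly n)))
    = int (k ^ n) * fact k"
proof (induction n)
  case 0
  then show ?case by (simp add: fact_functional_monom)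
next
  case (Suc n)
  define B where "B = stirling_poly n - pderiv (stirling_poly n)"
  have S: "stirling_poly (Suc n) = monom 1 1 * B"
    by (simp add: stirling_poly_Suc B_def monom_Suc)
  have B': "stirling_poly (Suc n) - pderiv (stirling_poly (Suc n))
      = monom 1 1 * B - B - monom 1 1 * pderiv B"
    by (simp add: S pderiv_mult pderiv_monom)
  have shift: "monom (1::int) k * monom 1 1 = monom 1 (Suc k)"
    by (simp add: mult_monom)
  have split: "monom 1 k * (monom 1 1 * B - B - monom 1 1 * pderiv B)
      = monom 1 (Suc k) * B - monom 1 k * B - monom 1 (Suc k) * pderiv B"
    by (simp only: right_diff_distrib shift flip: mult.assoc)
  \<comment> \<open>The product has no constant term, so differentiation leaves its value unchanged;
    the product rule then eliminates the term with \<open>pderiv B\<close>.\<close>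
  have "fact_functional (pderiv (monom 1 (Suc k) * B)) = fact_functional (monom 1 (Suc k) * B)"
    by (simp add: fact_functional_pderiv monom_Suc)
  moreover have "pderiv (monom 1 (Suc k) * B)
      = smult (int (Suc k)) (monom 1 k * B) + monom 1 (Suc k) * pderiv B"
    by (simp add: pderiv_mult pderiv_monom smult_monom flip: mult_smult_left)
  ultimately have "fact_functional (monom 1 (Suc k) * B) =
      int (Suc k) * fact_functional (monom 1 k * B) + fact_functional (monom 1 (Suc k) * pderiv B)"
    by (simp add: fact_functional_add fact_functional_smult)
  then have "fact_functional (monom 1 k * (monom 1 1 * B - B - monom 1 1 * pderiv B))
      = int k * fact_functional (monom 1 k * B)"
    unfolding split by (simp only: fact_functional_diff) (simp add: algebra_simps)
  then show ?case
    using Suc.IH unfolding B' B_def[symmetric] by simp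
qed

section \<open>Acyclic orientations with prescribed sinks\<close>

definition acyclic_orientations :: "'a rel \<Rightarrow> 'a rel set" where
  "acyclic_orientations E = {R. orientation E R \<and> acyclic R}"

lemma finite_acyclic_orientations: "finite E \<Longrightarrow> finite (acyclic_orientations E)"
  by (rule finite_subset[of _ "Pow E"]) (auto simp: acyclic_orientations_def orientation_def)

text \<open>A path that uses an edge of \<open>F\<close> ends in \<open>S\<close> and cannot
  continue, so no cycle contains such an edge. The proof uses well-foundedness, which is equivalent
  to acyclicity for finite relations.\<close>

lemma acyclic_Un_into_sinks:
  assumes "finite R" "finite F" "acyclic R"
    and "Domain R \<inter> S = {}" "Domain F \<inter> S = {}" "Range F \<subseteq> S"
  shows "acyclic (R \<union> F)"
proof -
  have "wf F"
  proof (rule wfI_min)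
    fix x :: 'a and Q
    assume "x \<in> Q"
    show "\<exists>z\<in>Q. \<forall>y. (y, z) \<in> F \<longrightarrow> y \<notin> Q"
    proof (cases "Q \<inter> Domain F = {}")
      case True
      then show ?thesis using \<open>x \<in> Q\<close> by auto
    next
      case False
      then obtain z where "z \<in> Q" "z \<in> Domain F" by blast
      \<comment> \<open>No edge of \<open>F\<close> ends in \<open>Domain F\<close>, so
        \<open>z\<close> has no predecessor at all.\<close>
      then show ?thesis using assms(5,6) by blast
    qed
  qed
  moreover have "wf R"
    using assms by (simp add: finite_acyclic_wf)
  ultimately have "wf (R \<union> F)"
    using assms(4,6) by (intro wf_Un) auto
  then show ?thesis
    by (rule wf_acyclic)
qed

text \<open>Every edge meeting \<open>S\<close> has exactly one end there and is forced to point to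
  it. Restriction to the complement therefore loses nothing, and adding these forced edges inverts
  it.\<close>

lemma card_acyclic_orientations_sinks:
  assumes "finite E" "sym E" and indep: "E \<inter> S \<times> S = {}"
  shows "card {R \<in> acyclic_orientations E. \<forall>v\<in>S. \<forall>w. (v, w) \<notin> R}
    = card (acyclic_orientations (Restr E (- S)))"
proof (rule bij_betw_same_card[OF bij_betw_byWitness
    [where f = "\<lambda>R. Restr R (- S)" and f' = "\<lambda>R. R \<union> E \<inter> (- S) \<times> S"]])
  have symE: "(v, u) \<in> E" if "(u, v) \<in> E" for u v
    using that \<open>sym E\<close> by (auto dest: symD)
  show "\<forall>R\<in>{R \<in> acyclic_orientations E. \<forall>v\<in>S. \<forall>w. (v, w) \<notin> R}.
      Restr R (- S) \<union> E \<inter> (- S) \<times> S = R"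
    using indep symE by (auto simp: acyclic_orientations_def orientation_def)
  show "\<forall>R\<in>acyclic_orientations (Restr E (- S)). Restr (R \<union> E \<inter> (- S) \<times> S) (- S) = R"
    by (auto simp: acyclic_orientations_def orientation_def)
  show "(\<lambda>R. Restr R (- S)) ` {R \<in> acyclic_orientations E. \<forall>v\<in>S. \<forall>w. (v, w) \<notin> R}
      \<subseteq> acyclic_orientations (Restr E (- S))"
    by (auto simp: acyclic_orientations_def orientation_def intro: acyclic_subset)
  show "(\<lambda>R. R \<union> E \<inter> (- S) \<times> S) ` acyclic_orientations (Restr E (- S))
      \<subseteq> {R \<in> acyclic_orientations E. \<forall>v\<in>S. \<forall>w. (v, w) \<notin> R}"
  proof (rule image_subsetI)
    fix R
    assume R: "R \<in> acyclic_orientations (Restr E (- S))"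
    then have sub: "R \<subseteq> Restr E (- S)"
      and ori: "\<And>u v. (u, v) \<in> Restr E (- S) \<Longrightarrow> (u, v) \<in> R \<longleftrightarrow> (v, u) \<notin> R"
      and "acyclic R"
      by (auto simp: acyclic_orientations_def orientation_def)
    have "finite R"
      using sub \<open>finite E\<close> by (meson finite_Int finite_subset)
    then have "acyclic (R \<union> E \<inter> (- S) \<times> S)"
      using \<open>finite E\<close> \<open>acyclic R\<close> sub by (intro acyclic_Un_into_sinks[where S = S]) auto
    moreover have "orientation E (R \<union> E \<inter> (- S) \<times> S)"
      unfolding orientation_def
    proof (intro conjI allI impI)
      show "R \<union> E \<inter> (- S) \<times> S \<subseteq> E" using sub by auto
      fix u v
      assume uv: "(u, v) \<in> E"
      show "(u, v) \<in> R \<union> E \<inter> (- S) \<times> S \<longleftrightarrow> (v, u) \<notin> R \<union> E \<inter> (- S) \<times> S"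
        using uv symE[OF uv] indep sub ori[of u v] by blast
    qed
    ultimately show "R \<union> E \<inter> (- S) \<times> S
        \<in> {R \<in> acyclic_orientations E. \<forall>v\<in>S. \<forall>w. (v, w) \<notin> R}"
      using sub by (auto simp: acyclic_orientations_def)
  qed
qed

lemma alternating_sum_Pow:
  assumes "finite A"
  shows "(\<Sum>T\<in>Pow A. (-1 :: int) ^ card T) = of_bool (A = {})"
proof -
  have "(\<Sum>T\<in>Pow A. (-1 :: int) ^ card T) = (\<Prod>x\<in>A. 1 - 1)"
    using prod_diff_conv_sum[OF assms, where ?f1.0 = "\<lambda>_. 1 :: int" and ?f2.0 = "\<lambda>_. 1"] by simp
  then show ?thesis
    using assms by (simp add: power_0_left)
qed

text \<open>Inclusion-exclusion over the sets \<open>T\<close> of further prescribed sinks. It is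
  applied with \<open>C\<close> empty, and with \<open>C\<close> consisting of the desired unique
  sink.\<close>

lemma card_acyclic_orientations_sinks_eq:
  assumes "finite V" "E \<subseteq> V \<times> V" "sym E" "C \<subseteq> V"
  shows "int (card {R \<in> acyclic_orientations E. Collect (is_sink V R) = C}) =
    (\<Sum>T | T \<subseteq> V - C \<and> E \<inter> (C \<union> T) \<times> (C \<union> T) = {}.
       (-1) ^ card T * int (card (acyclic_orientations (Restr E (- (C \<union> T))))))"
proof -
  have finE: "finite E"
    using assms by (meson finite_SigmaI finite_subset)
  let ?A = "acyclic_orientations E"
  let ?P = "\<lambda>R T. C \<union> T \<subseteq> Collect (is_sink V R)"
  note finA = finite_acyclic_orientations[OF finE]
  \<comment> \<open>For fixed \<open>R\<close>, the sets \<open>T\<close> that count are the subsets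
    of the surplus sinks \<open>?D\<close>, so the alternating sum detects whether there is any
    surplus.\<close>
  have inner: "(\<Sum>T\<in>Pow (V - C). (-1 :: int) ^ card T * of_bool (?P R T))
      = of_bool (Collect (is_sink V R) = C)" for R
  proof (cases "C \<subseteq> Collect (is_sink V R)")
    case True
    let ?D = "Collect (is_sink V R) - C"
    have "?D \<subseteq> V - C" by (auto simp: is_sink_def)
    then have "(\<Sum>T\<in>Pow (V - C). (-1 :: int) ^ card T * of_bool (?P R T))
        = (\<Sum>T\<in>Pow ?D. (-1) ^ card T)"
      using True \<open>finite V\<close> by (intro sum.mono_neutral_cong_right) auto
    also have "\<dots> = of_bool (?D = {})"
      using \<open>finite V\<close> by (intro alternating_sum_Pow) (rule finite_subset[OF \<open>?D \<subseteq> V - C\<close>], simp)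
    finally show ?thesis
      using True by auto
  qed auto
  have count: "(\<Sum>R\<in>?A. of_bool (?P R T)) = (if E \<inter> (C \<union> T) \<times> (C \<union> T) = {}
      then int (card (acyclic_orientations (Restr E (- (C \<union> T))))) else 0)"
    if "T \<in> Pow (V - C)" for T
  proof -
    have sinks: "?P R T \<longleftrightarrow> (\<forall>v\<in>C \<union> T. \<forall>w. (v, w) \<notin> R)" for R
      using that \<open>C \<subseteq> V\<close> by (auto simp: is_sink_def)
    have "(\<Sum>R\<in>?A. of_bool (?P R T)) = int (card {R \<in> ?A. ?P R T})"
      using finA by (simp add: of_bool_def sum.If_cases Int_def)
    also have "\<dots> = (if E \<inter> (C \<union> T) \<times> (C \<union> T) = {}
      then int (card (acyclic_orientations (Restr E (- (C \<union> T))))) else 0)"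
    proof (cases "E \<inter> (C \<union> T) \<times> (C \<union> T) = {}")
      case True
      then show ?thesis
        unfolding sinks using card_acyclic_orientations_sinks[OF finE \<open>sym E\<close> True] by simp
    next
      case False
      \<comment> \<open>An edge inside \<open>C \<union> T\<close> leaves one of its ends, which is
        then not a sink.\<close>
      then obtain u v where "(u, v) \<in> E" "u \<in> C \<union> T" "v \<in> C \<union> T" by blast
      then have "{R \<in> ?A. ?P R T} = {}"
        unfolding sinks acyclic_orientations_def orientation_def by blast
      then show ?thesis by (simp only: False if_False card.empty of_nat_0)
    qed
    finally show ?thesis .
  qed
  have "int (card {R \<in> ?A. Collect (is_sink V R) = C})
      = (\<Sum>R\<in>?A. of_bool (Collect (is_sink V R) = C))"
    using finA by (simp add: of_bool_def sum.If_cases Int_def)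
  also have "\<dots> = (\<Sum>R\<in>?A. \<Sum>T\<in>Pow (V - C). (-1) ^ card T * of_bool (?P R T))"
    by (simp only: inner)
  also have "\<dots> = (\<Sum>T\<in>Pow (V - C). \<Sum>R\<in>?A. (-1) ^ card T * of_bool (?P R T))"
    by (rule sum.swap)
  also have "\<dots> = (\<Sum>T\<in>Pow (V - C). (-1) ^ card T * (\<Sum>R\<in>?A. of_bool (?P R T)))"
    by (simp only: sum_distrib_left)
  also have "\<dots> = (\<Sum>T\<in>Pow (V - C). (-1) ^ card T * (if E \<inter> (C \<union> T) \<times> (C \<union> T) = {}
      then int (card (acyclic_orientations (Restr E (- (C \<union> T))))) else 0))"
    by (intro sum.cong refl) (simp only: count)
  also have "\<dots> = (\<Sum>T | T \<subseteq> V - C \<and> E \<inter> (C \<union> T) \<times> (C \<union> T) = {}.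
       (-1) ^ card T * int (card (acyclic_orientations (Restr E (- (C \<union> T))))))"
    using \<open>finite V\<close> by (intro sum.mono_neutral_cong_right) auto
  finally show ?thesis .
qed

text \<open>By finiteness the converse of \<open>R\<close> is well-founded, and a minimal vertex for
  it has no successor in \<open>V\<close>, hence none at all.\<close>

lemma acyclic_orientation_has_sink:
  assumes "finite V" "V \<noteq> {}" "E \<subseteq> V \<times> V" "R \<in> acyclic_orientations E"
  shows "Collect (is_sink V R) \<noteq> {}"
proof -
  have R: "R \<subseteq> E" "acyclic R"
    using assms(4) by (auto simp: acyclic_orientations_def orientation_def)
  then have "finite R"
    using assms by (meson finite_SigmaI finite_subset)
  then have "wf (R\<inverse>)"
    using R by (simp add: finite_acyclic_wf_converse)
  then obtain z where "z \<in> V" "\<And>y. (y, z) \<in> R\<inverse> \<Longrightarrow> y \<notin> V"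
    using \<open>V \<noteq> {}\<close> by (metis ex_in_conv wfE_min)
  then have "is_sink V R z"
    using R assms(3) by (auto simp: is_sink_def)
  then show ?thesis by blast
qed

section \<open>Complete multipartite graphs\<close>

text \<open>Parts are given as colour classes, possibly empty, so that deleting vertices only
  shrinks \<open>V\<close> and induced subgraphs keep the same form.\<close>

definition colour_edges :: "('a \<Rightarrow> 'i) \<Rightarrow> 'a set \<Rightarrow> 'a rel" where
  "colour_edges c V = {(u, v). u \<in> V \<and> v \<in> V \<and> c u \<noteq> c v}"

definition colour_class :: "('a \<Rightarrow> 'i) \<Rightarrow> 'a set \<Rightarrow> 'i \<Rightarrow> 'a set" where
  "colour_class c V i = {v \<in> V. c v = i}"

lemma colour_edges_subset: "colour_edges c V \<subseteq> V \<times> V"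
  by (auto simp: colour_edges_def)

lemma sym_colour_edges: "sym (colour_edges c V)"
  by (auto simp: colour_edges_def sym_def)

lemma Restr_colour_edges: "Restr (colour_edges c V) (- S) = colour_edges c (V - S)"
  by (auto simp: colour_edges_def)

lemma finite_colour_class: "finite V \<Longrightarrow> finite (colour_class c V i)"
  by (simp add: colour_class_def)

section \<open>The number of all acyclic orientations\<close>

lemma sum_Pow_card:
  fixes h :: "nat \<Rightarrow> int"
  assumes "finite A"
  shows "(\<Sum>T\<in>Pow A. h (card T)) = (\<Sum>j\<le>card A. int (card A choose j) * h j)"
proof -
  have "(\<Sum>T\<in>Pow A. h (card T))
      = (\<Sum>j\<le>card A. \<Sum>T\<in>{T \<in> Pow A. card T = j}. h (card T))"
    using assms by (intro sum.group[symmetric]) (auto intro: card_mono)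
  also have "\<dots> = (\<Sum>j\<le>card A. int (card A choose j) * h j)"
    using n_subsets[OF assms] by (intro sum.cong refl) simp
  finally show ?thesis .
qed

lemma prod_stirling_poly_Diff:
  assumes "finite V" "finite I" "i \<in> I" "T \<subseteq> colour_class c V i"
  shows "(\<Prod>l\<in>I. stirling_poly (card (colour_class c (V - T) l))) =
    (\<Prod>l\<in>I - {i}. stirling_poly (card (colour_class c V l))) *
    stirling_poly (card (colour_class c V i) - card T)"
proof -
  have "colour_class c (V - T) i = colour_class c V i - T"
    by (auto simp: colour_class_def)
  moreover have "card (colour_class c V i - T) = card (colour_class c V i) - card T"
    using assms finite_colour_class[of V c i] by (simp add: card_Diff_subset finite_subset)
  moreover have "colour_class c (V - T) l = colour_class c V l" if "l \<noteq> i" for l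
    using that assms(4) by (auto simp: colour_class_def)
  ultimately show ?thesis
    using assms by (simp add: prod.remove[of I i] mult.commute)
qed

lemma fact_functional_alternating_sum:
  fixes f :: "nat \<Rightarrow> int poly"
  shows "(\<Sum>j\<in>J. int (m choose j) * ((-1) ^ j * fact_functional (r * f j)))
    = fact_functional (r * (\<Sum>j\<in>J. of_nat (m choose j) * (-1) ^ j * f j))"
proof -
  have "int (m choose j) * ((-1) ^ j * fact_functional (r * f j))
      = fact_functional (r * (of_nat (m choose j) * (-1) ^ j * f j))" for j
  proof -
    have "r * (of_nat (m choose j) * (-1) ^ j * f j)
        = smult (int (m choose j) * (-1) ^ j) (r * f j)"
      by (cases "even j") (simp_all add: of_nat_poly)
    then show ?thesis
      by (simp add: fact_functional_smult)
  qed
  then show ?thesis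
    by (simp add: sum_distrib_left fact_functional_sum)
qed

text \<open>A single nonempty part already contributes a factor divisible by
  \<open>x\<close>.\<close>

lemma coeff_0_prod_stirling_poly:
  assumes "finite I" "i \<in> I" "f i > 0"
  shows "coeff (\<Prod>l\<in>I. stirling_poly (f l)) 0 = 0"
  using assms by (simp add: prod.remove[of I i] coeff_mult_0 coeff_stirling_poly)

text \<open>Strong induction on \<open>V\<close>. Inclusion-exclusion with no prescribed sink
  expresses the count for \<open>V\<close> through those for \<open>V - T\<close>, with
  \<open>T\<close> a nonempty subset of one part. By induction these add up to the functional of the
  derivative of the product, which equals that of the product itself.\<close>

theorem card_acyclic_orientations_colour_edges:
  assumes "finite V" "finite I" "c ` V \<subseteq> I"
  shows "int (card (acyclic_orientations (colour_edges c V)))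
    = fact_functional (\<Prod>i\<in>I. stirling_poly (card (colour_class c V i)))"
  using assms(1,3)
proof (induction V rule: finite_psubset_induct)
  case (psubset V)
  let ?a = "\<lambda>V. int (card (acyclic_orientations (colour_edges c V)))"
  let ?W = "colour_class c V"
  let ?Q = "\<Prod>i\<in>I. stirling_poly (card (?W i))"
  let ?r = "\<lambda>i. \<Prod>l\<in>I - {i}. stirling_poly (card (?W l))"
  show ?case
  proof (cases "V = {}")
    case True
    have "acyclic_orientations ({} :: 'a rel) = {{}}"
      by (auto simp: acyclic_orientations_def orientation_def acyclic_def)
    with True show ?thesis
      by (simp add: colour_edges_def colour_class_def fact_functional_def)
  next
    case False
    then obtain v where "v \<in> V" by blast
    have fin: "finite (?W i)" for i
      by (rule finite_colour_class) fact
    have coeff0: "coeff ?Q 0 = 0"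
    proof (rule coeff_0_prod_stirling_poly)
      show "c v \<in> I" using \<open>v \<in> V\<close> psubset.prems by blast
      have "v \<in> ?W (c v)" using \<open>v \<in> V\<close> by (simp add: colour_class_def)
      then show "card (?W (c v)) > 0" using fin card_gt_0_iff by blast
    qed fact
    let ?Ind = "{T. T \<subseteq> V \<and> colour_edges c V \<inter> T \<times> T = {}}"
    have no_sinks: "{R \<in> acyclic_orientations (colour_edges c V). Collect (is_sink V R) = {}} = {}"
      using acyclic_orientation_has_sink[OF \<open>finite V\<close> False colour_edges_subset] by blast
    \<comment> \<open>The left side is 0 because an acyclic orientation of a nonempty finite graph
      has a sink.\<close>
    have "0 = (\<Sum>T\<in>?Ind. (-1) ^ card T * ?a (V - T))"
      using card_acyclic_orientations_sinks_eq[OF \<open>finite V\<close> colour_edges_subset[of c V]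
          sym_colour_edges, of "{}"]
      unfolding no_sinks by (simp add: Restr_colour_edges)
    also have "\<dots> = ?a V + (\<Sum>T\<in>?Ind - {{}}. (-1) ^ card T * ?a (V - T))"
      using \<open>finite V\<close> by (subst sum.remove[where x = "{}"]) auto
    \<comment> \<open>Independent sets lie within one part; nonemptiness makes that part unique, so
      the union is disjoint.\<close>
    also have "?Ind - {{}} = (\<Union>i\<in>I. Pow (?W i) - {{}})"
    proof (intro equalityI subsetI)
      fix T assume T: "T \<in> ?Ind - {{}}"
      then have "T \<subseteq> V" and ind: "colour_edges c V \<inter> T \<times> T = {}" and "T \<noteq> {}"
        by simp_all
      then obtain t where "t \<in> T" by blast
      have "c u = c t" if "u \<in> T" for u
      proof (rule ccontr)
        assume "c u \<noteq> c t"
        with \<open>T \<subseteq> V\<close> \<open>t \<in> T\<close> that have "(u, t) \<in> colour_edges c V \<inter> T \<times> T"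
          by (auto simp: colour_edges_def)
        with ind show False by simp
      qed
      with \<open>T \<subseteq> V\<close> have "T \<subseteq> ?W (c t)"
        by (auto simp: colour_class_def)
      moreover have "c t \<in> I"
        using \<open>T \<subseteq> V\<close> \<open>t \<in> T\<close> psubset.prems by blast
      ultimately show "T \<in> (\<Union>i\<in>I. Pow (?W i) - {{}})"
        using \<open>T \<noteq> {}\<close> by blast
    qed (auto simp: colour_class_def colour_edges_def)
    also have "(\<Sum>T\<in>(\<Union>i\<in>I. Pow (?W i) - {{}}). (-1) ^ card T * ?a (V - T)) =
        (\<Sum>i\<in>I. \<Sum>T\<in>Pow (?W i) - {{}}. (-1) ^ card T * ?a (V - T))"
    proof (rule sum.UNION_disjoint)
      have "False" if "i \<noteq> j" "T \<noteq> {}" "T \<subseteq> ?W i" "T \<subseteq> ?W j" for i j T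
        using that by (auto simp: colour_class_def)
      then show "\<forall>i\<in>I. \<forall>j\<in>I. i \<noteq> j \<longrightarrow> (Pow (?W i) - {{}}) \<inter> (Pow (?W j) - {{}}) = {}"
        by blast
    qed (use fin \<open>finite I\<close> in auto)
    also have "\<dots> = (\<Sum>i\<in>I. - fact_functional (?r i * pderiv (stirling_poly (card (?W i)))))"
    proof (rule sum.cong)
      fix i assume "i \<in> I"
      let ?m = "card (?W i)"
      let ?h = "\<lambda>j. (-1) ^ j * fact_functional (?r i * stirling_poly (?m - j))"
      have "(-1) ^ card T * ?a (V - T) = ?h (card T)" if "T \<in> Pow (?W i) - {{}}" for T
      proof -
        have "V - T \<subset> V" using that by (auto simp: colour_class_def)
        then have "?a (V - T)
            = fact_functional (\<Prod>l\<in>I. stirling_poly (card (colour_class c (V - T) l)))"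
          using psubset.prems by (intro psubset.IH) auto
        then show ?thesis
          using that \<open>i \<in> I\<close> \<open>finite I\<close> \<open>finite V\<close> by (simp add: prod_stirling_poly_Diff)
      qed
      then have "(\<Sum>T\<in>Pow (?W i) - {{}}. (-1) ^ card T * ?a (V - T))
          = (\<Sum>T\<in>Pow (?W i) - {{}}. ?h (card T))"
        by (rule sum.cong[OF refl])
      also have "\<dots> = (\<Sum>T\<in>Pow (?W i). ?h (card T)) - ?h 0"
        using fin[of i] by (simp add: sum_diff1)
      also have "\<dots> = (\<Sum>j\<le>?m. int (?m choose j) * ?h j) - ?h 0"
        using sum_Pow_card[OF fin, of ?h] by (simp only:)
      also have "\<dots> = (\<Sum>j=1..?m. int (?m choose j) * ?h j)"
      proof -
        have "{..?m} = insert 0 {1..?m}" by auto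
        then show ?thesis by simp
      qed
      also have "\<dots> = - fact_functional (?r i * pderiv (stirling_poly ?m))"
        unfolding fact_functional_alternating_sum pderiv_stirling_poly
        by (simp add: fact_functional_minus)
      finally show "(\<Sum>T\<in>Pow (?W i) - {{}}. (-1) ^ card T * ?a (V - T))
        = - fact_functional (?r i * pderiv (stirling_poly ?m))" .
    qed simp
    \<comment> \<open>The product rule: the summand for \<open>i\<close> differentiates the factor
      of part \<open>i\<close>.\<close>
    also have "\<dots> = - fact_functional (pderiv ?Q)"
      by (simp add: pderiv_prod fact_functional_sum sum_negf)
    also have "\<dots> = - fact_functional ?Q"
      by (simp add: fact_functional_pderiv coeff0)
    finally show ?thesis by simp
  qed
qed

section \<open>Unique sinks and the explicit sum\<close>

text \<open>With \<open>s\<close> prescribed, the further sinks form an arbitrary, possibly empty,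
  subset of the \<open>d\<close> other vertices in its part. The sum thus starts at
  \<open>j = 0\<close>, and its distinguished factor is \<open>stirling_poly (Suc d)\<close> divided
  by \<open>x\<close>.\<close>

lemma card_unique_sink_colour_edges:
  assumes "finite V" "finite I" "c ` V \<subseteq> I" "s \<in> V"
  defines "d \<equiv> card (colour_class c V (c s)) - 1"
  shows "int (card (acyclic_orientations_unique_sink V (colour_edges c V) s))
    = fact_functional ((\<Prod>i\<in>I - {c s}. stirling_poly (card (colour_class c V i))) *
        (stirling_poly d - pderiv (stirling_poly d)))"
proof -
  let ?W = "colour_class c V (c s) - {s}"
  let ?r = "\<Prod>i\<in>I - {c s}. stirling_poly (card (colour_class c V i))"
  let ?h = "\<lambda>j. (-1) ^ j * fact_functional (?r * stirling_poly (d - j))"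
  have s: "s \<in> colour_class c V (c s)" using \<open>s \<in> V\<close> by (simp add: colour_class_def)
  have fin: "finite ?W" using \<open>finite V\<close> by (simp add: finite_colour_class)
  have card: "card ?W = d"
    using s by (simp add: d_def)
  have "int (card (acyclic_orientations_unique_sink V (colour_edges c V) s))
    = int (card {R \<in> acyclic_orientations (colour_edges c V). Collect (is_sink V R) = {s}})"
    unfolding acyclic_orientations_unique_sink_def acyclic_orientations_def
    by (rule arg_cong[where f = "\<lambda>A. int (card A)"]) blast
  also have "\<dots> = (\<Sum>T | T \<subseteq> V - {s} \<and> colour_edges c V \<inter> ({s} \<union> T) \<times> ({s} \<union> T) = {}.
       (-1) ^ card T * int (card (acyclic_orientations (colour_edges c (V - ({s} \<union> T))))))"
    using card_acyclic_orientations_sinks_eq[OF \<open>finite V\<close> colour_edges_subset[of c V]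
          sym_colour_edges, of "{s}"] \<open>s \<in> V\<close>
    by (simp only: Restr_colour_edges empty_subsetI insert_subset)
  also have "{T. T \<subseteq> V - {s} \<and> colour_edges c V \<inter> ({s} \<union> T) \<times> ({s} \<union> T) = {}} = Pow ?W"
  proof (intro equalityI subsetI)
    fix T assume T: "T \<in> Pow ?W"
    then have "c u = c s" "u \<noteq> s" "u \<in> V" if "u \<in> T" for u
      using that by (auto simp: colour_class_def)
    then show "T \<in> {T. T \<subseteq> V - {s} \<and> colour_edges c V \<inter> ({s} \<union> T) \<times> ({s} \<union> T) = {}}"
      by (auto simp: colour_edges_def)
  next
    fix T assume "T \<in> {T. T \<subseteq> V - {s} \<and> colour_edges c V \<inter> ({s} \<union> T) \<times> ({s} \<union> T) = {}}"
    with \<open>s \<in> V\<close> show "T \<in> Pow ?W"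
      by (auto simp: colour_edges_def colour_class_def)
  qed
  also have "(\<Sum>T\<in>Pow ?W.
       (-1) ^ card T * int (card (acyclic_orientations (colour_edges c (V - ({s} \<union> T))))))
    = (\<Sum>T\<in>Pow ?W. ?h (card T))"
  proof (rule sum.cong)
    fix T assume T: "T \<in> Pow ?W"
    then have "card ({s} \<union> T) = Suc (card T)"
      using finite_subset[OF _ fin] by (subst card_Un_disjoint) auto
    \<comment> \<open>The vertex \<open>s\<close> is deleted together with \<open>T\<close>, which
      accounts for the 1 subtracted in \<open>d\<close>.\<close>
    then have m: "card (colour_class c V (c s)) - card ({s} \<union> T) = d - card T"
      by (simp add: d_def)
    have sub: "{s} \<union> T \<subseteq> colour_class c V (c s)" and cs: "c s \<in> I"
      using T s assms(3,4) by auto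
    have "int (card (acyclic_orientations (colour_edges c (V - ({s} \<union> T)))))
      = fact_functional (\<Prod>i\<in>I. stirling_poly (card (colour_class c (V - ({s} \<union> T)) i)))"
      using assms(1-3) by (intro card_acyclic_orientations_colour_edges) auto
    also have "\<dots> = fact_functional (?r * stirling_poly (d - card T))"
      unfolding prod_stirling_poly_Diff[OF assms(1,2) cs sub] m ..
    finally show "(-1) ^ card T * int (card (acyclic_orientations (colour_edges c (V - ({s} \<union> T)))))
      = ?h (card T)"
      by simp
  qed simp
  also have "\<dots> = (\<Sum>j\<le>d. int (d choose j) * ?h j)"
    using sum_Pow_card[OF fin, of ?h] by (simp only: card)
  also have "\<dots> = fact_functional (?r * (stirling_poly d - pderiv (stirling_poly d)))"
    unfolding fact_functional_alternating_sum stirling_poly_diff_pderiv ..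
  finally show ?thesis .
qed

text \<open>Multiplying by the indeterminate completes the distinguished factor to
  \<open>stirling_poly (f i)\<close>, so the choice of \<open>i\<close> is immaterial: this is the independence of the
  count from the sink.\<close>

lemma prod_stirling_poly_distinguished_eq:
  assumes "finite I" "i \<in> I" "j \<in> I" "\<And>l. l \<in> I \<Longrightarrow> f l > 0"
  shows "(\<Prod>l\<in>I - {i}. stirling_poly (f l)) *
      (stirling_poly (f i - 1) - pderiv (stirling_poly (f i - 1))) =
    (\<Prod>l\<in>I - {j}. stirling_poly (f l)) *
      (stirling_poly (f j - 1) - pderiv (stirling_poly (f j - 1)))"
proof -
  have "pCons 0 ((\<Prod>l\<in>I - {i}. stirling_poly (f l)) *
      (stirling_poly (f i - 1) - pderiv (stirling_poly (f i - 1))))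
    = (\<Prod>l\<in>I. stirling_poly (f l))" if "i \<in> I" for i
  proof -
    have "stirling_poly (f i)
        = pCons 0 (stirling_poly (f i - 1) - pderiv (stirling_poly (f i - 1)))"
      using stirling_poly_Suc[of "f i - 1"] assms(4)[OF that] by simp
    then show ?thesis
      using \<open>finite I\<close> that by (simp add: prod.remove[of I i] mult.commute)
  qed
  from this[OF assms(2)] this[OF assms(3)] show ?thesis
    by (metis pCons_eq_iff)
qed

text \<open>Expanding the product gives one monomial for each tuple \<open>k\<close>, of degree the
  sum of its entries, to which \<open>fact_functional_monom_mult_diff\<close> applies.\<close>

lemma fact_functional_prod_mult_diff:
  assumes "finite I" "\<And>i. i \<in> I \<Longrightarrow> f i > 0"
  shows "fact_functional ((\<Prod>i\<in>I. stirling_poly (f i)) *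
      (stirling_poly d - pderiv (stirling_poly d))) =
    (\<Sum>k \<in> (\<Pi>\<^sub>E i\<in>I. {1..f i}). (-1) ^ ((\<Sum>i\<in>I. f i) - (\<Sum>i\<in>I. k i))
       * int ((\<Sum>i\<in>I. k i) ^ d) * fact (\<Sum>i\<in>I. k i)
       * (\<Prod>i\<in>I. int (Stirling (f i) (k i))))"
proof -
  let ?B = "stirling_poly d - pderiv (stirling_poly d)"
  let ?t = "\<lambda>i k. monom ((-1) ^ (f i - k) * int (Stirling (f i) k)) k"
  have "stirling_poly (f i) = (\<Sum>k\<in>{1..f i}. ?t i k)" if "i \<in> I" for i
  proof -
    \<comment> \<open>The index 0 drops out because \<open>Stirling (f i) 0\<close> vanishes for
      positive \<open>f i\<close>.\<close>
    have "{..f i} = insert 0 {1..f i}" by auto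
    then show ?thesis
      using assms(2)[OF that] by (simp add: stirling_poly_def)
  qed
  then have "(\<Prod>i\<in>I. stirling_poly (f i)) = (\<Prod>i\<in>I. \<Sum>k\<in>{1..f i}. ?t i k)"
    by (rule prod.cong[OF refl])
  also have "\<dots> = (\<Sum>k \<in> (\<Pi>\<^sub>E i\<in>I. {1..f i}). \<Prod>i\<in>I. ?t i (k i))"
    using \<open>finite I\<close> by (rule prod_sum_PiE) simp
  finally have Q: "(\<Prod>i\<in>I. stirling_poly (f i)) = \<dots>" .
  have monoms: "(\<Prod>i\<in>J. ?t i (k i))
      = monom (\<Prod>i\<in>J. (-1) ^ (f i - k i) * int (Stirling (f i) (k i))) (\<Sum>i\<in>J. k i)"
    for k and J
    by (induction J rule: infinite_finite_induct) (simp_all add: mult_monom)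
  have "fact_functional ((\<Prod>i\<in>I. ?t i (k i)) * ?B)
    = (-1) ^ ((\<Sum>i\<in>I. f i) - (\<Sum>i\<in>I. k i))
       * int ((\<Sum>i\<in>I. k i) ^ d) * fact (\<Sum>i\<in>I. k i)
       * (\<Prod>i\<in>I. int (Stirling (f i) (k i)))" if "k \<in> (\<Pi>\<^sub>E i\<in>I. {1..f i})" for k
  proof -
    let ?K = "\<Sum>i\<in>I. k i"
    let ?c = "\<Prod>i\<in>I. (-1) ^ (f i - k i) * int (Stirling (f i) (k i))"
    have "(\<Prod>i\<in>I. ?t i (k i)) * ?B = smult ?c (monom 1 ?K * ?B)"
      unfolding monoms by (simp add: smult_monom flip: mult_smult_left)
    then have "fact_functional ((\<Prod>i\<in>I. ?t i (k i)) * ?B) = ?c * (int (?K ^ d) * fact ?K)"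
      by (simp only: fact_functional_smult fact_functional_monom_mult_diff)
    \<comment> \<open>The bounds \<open>k i \<le> f i\<close> make truncated subtraction commute
      with the sum.\<close>
    moreover have "(\<Sum>i\<in>I. f i - k i) = (\<Sum>i\<in>I. f i) - ?K"
      using that by (intro sum_subtractf_nat) auto
    then have "?c = (-1) ^ ((\<Sum>i\<in>I. f i) - ?K) * (\<Prod>i\<in>I. int (Stirling (f i) (k i)))"
      by (simp add: prod.distrib flip: power_sum)
    ultimately show ?thesis
      by simp
  qed
  then show ?thesis
    unfolding Q sum_distrib_right fact_functional_sum by (rule sum.cong[OF refl])
qed

theorem theorem6p7:
  fixes N :: nat and n :: "nat \<Rightarrow> nat" and m :: "nat \<Rightarrow> nat" and s :: "nat \<times> nat"
  assumes "N \<ge> 2"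
    and "\<And>i. i \<in> {2..N} \<Longrightarrow> n i \<ge> 1"
    and "m = n(1 := n 1 + 1)"
    and "s \<in> multipartite_verts N m"
  shows "int (card (acyclic_orientations_unique_sink
             (multipartite_verts N m) (multipartite_adj N m) s)) =
    (\<Sum>k \<in> (\<Pi>\<^sub>E i\<in>{2..N}. {1..n i}).
       (-1) ^ ((\<Sum>i=2..N. n i) - (\<Sum>i=2..N. k i))
       * int ((\<Sum>i=2..N. k i) ^ n 1)
       * fact (\<Sum>i=2..N. k i)
       * (\<Prod>i=2..N. int (Stirling (n i) (k i))))"
proof -
  let ?V = "multipartite_verts N m"
  have finV: "finite ?V"
    by (simp add: multipartite_verts_def)
  have adj: "multipartite_adj N m = colour_edges fst ?V"
    by (simp add: multipartite_adj_def colour_edges_def)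
  have img: "fst ` ?V \<subseteq> {1..N}"
    by (auto simp: multipartite_verts_def)
  have class_card: "card (colour_class fst ?V i) = m i" if "i \<in> {1..N}" for i
  proof -
    have "colour_class fst ?V i = Pair i ` {1..m i}"
      using that by (auto simp: colour_class_def multipartite_verts_def)
    then show ?thesis
      by (simp add: card_image inj_on_def)
  qed
  have pos: "m i > 0" if "i \<in> {1..N}" for i
    using that assms(2)[of i] assms(3) by (cases "i = 1") auto
  have fs: "fst s \<in> {1..N}"
    using img assms(4) by blast
  have others: "{1..N} - {1} = {2..N}" by auto
  have prods: "(\<Prod>i\<in>{1..N} - {fst s}. stirling_poly (card (colour_class fst ?V i)))
      = (\<Prod>i\<in>{1..N} - {fst s}. stirling_poly (m i))"
    by (rule prod.cong) (simp_all add: class_card)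
  have "int (card (acyclic_orientations_unique_sink ?V (multipartite_adj N m) s))
    = fact_functional ((\<Prod>i\<in>{1..N} - {fst s}. stirling_poly (m i)) *
        (stirling_poly (m (fst s) - 1) - pderiv (stirling_poly (m (fst s) - 1))))"
    unfolding adj
    using card_unique_sink_colour_edges[OF finV _ img assms(4)] class_card[OF fs] prods by simp
  \<comment> \<open>The sink is moved to part 1, whose remaining \<open>m 1 - 1\<close> vertices
    number exactly \<open>n 1\<close>.\<close>
  also have "\<dots> = fact_functional ((\<Prod>i\<in>{1..N} - {1}. stirling_poly (m i)) *
        (stirling_poly (m 1 - 1) - pderiv (stirling_poly (m 1 - 1))))"
    using fs pos assms(1) by (subst prod_stirling_poly_distinguished_eq[of _ _ 1]) auto
  also have "\<dots> = fact_functional ((\<Prod>i\<in>{2..N}. stirling_poly (n i)) *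
        (stirling_poly (n 1) - pderiv (stirling_poly (n 1))))"
    unfolding others assms(3) by simp
  also have "\<dots> = (\<Sum>k \<in> (\<Pi>\<^sub>E i\<in>{2..N}. {1..n i}).
       (-1) ^ ((\<Sum>i=2..N. n i) - (\<Sum>i=2..N. k i))
       * int ((\<Sum>i=2..N. k i) ^ n 1)
       * fact (\<Sum>i=2..N. k i)
       * (\<Prod>i=2..N. int (Stirling (n i) (k i))))"
    by (rule fact_functional_prod_mult_diff) (use assms(2) in \<open>force+\<close>)
  finally show ?thesis .
qed

end
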